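(* Let $X\subseteq\mathbb{R}^n$ and $f\colon X\to\{-1,1\}$, and let $d$ be an integer. Then \[R^+(f,2d)\leq\left(\frac{\epsilon}{1+\sqrt{1-\epsilon^2}}\right)^2,\qquad\text{where }\epsilon=R(f,d).\]
   Context: $R(f,d)=\inf_{p,q}\sup_{x\in X}|f(x)-p(x)/q(x)|$, the infimum over real polynomials $p,q$ of total degree at most $d$ such that $q$ does not vanish on $X$. $R^+(f,d)$ is defined identically except that the infimum is over $p,q$ of degree at most $d$ with $q$ positive on $X$. *)

theory Defs
  imports "HOL-Analysis.Analysis"
begin

text \<open>
  A multi-index \<open>m :: 'n \<Rightarrow> nat\<close> stands for the monomial with exponent \<open>m i\<close> in the
  \<open>i\<close>-th variable; its total degree is the sum of the exponents. Since the reals are infinite,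
  polynomials over them are identified with the functions they induce.
\<close>

definition poly_funs :: "nat \<Rightarrow> (real ^ 'n \<Rightarrow> real) set" where
  "poly_funs d = {p. \<exists>c :: ('n \<Rightarrow> nat) \<Rightarrow> real.
      \<forall>x. p x = (\<Sum>m | (\<Sum>i\<in>UNIV. m i) \<le> d. c m * (\<Prod>i\<in>UNIV. (x $ i) ^ m i))}"

text \<open>
  The errors take values in \<open>ennreal\<close>: a supremum may be infinite when \<open>X\<close> is infinite, and the
  supremum over an empty \<open>X\<close> is \<open>0\<close>. On type \<open>real\<close> both would be junk values.
\<close>

definition rat_err :: "(real ^ 'n) set \<Rightarrow> (real ^ 'n \<Rightarrow> real) \<Rightarrow> nat \<Rightarrow> ennreal" where
  "rat_err X f d =
     (INF (p, q) \<in> {(p, q). p \<in> poly_funs d \<and> q \<in> poly_funs d \<and> (\<forall>x\<in>X. q x \<noteq> 0)}.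
        SUP x\<in>X. ennreal \<bar>f x - p x / q x\<bar>)"

definition rat_err_pos :: "(real ^ 'n) set \<Rightarrow> (real ^ 'n \<Rightarrow> real) \<Rightarrow> nat \<Rightarrow> ennreal" where
  "rat_err_pos X f d =
     (INF (p, q) \<in> {(p, q). p \<in> poly_funs d \<and> q \<in> poly_funs d \<and> (\<forall>x\<in>X. q x > 0)}.
        SUP x\<in>X. ennreal \<bar>f x - p x / q x\<bar>)"

text \<open>The sum defining \<open>poly_funs\<close> is a genuine finite sum.\<close>

lemma finite_multi_indices: "finite {m :: 'n::finite \<Rightarrow> nat. (\<Sum>i\<in>UNIV. m i) \<le> d}"
proof (rule finite_subset)
  show "{m :: 'n \<Rightarrow> nat. (\<Sum>i\<in>UNIV. m i) \<le> d} \<subseteq> (UNIV :: 'n set) \<rightarrow>\<^sub>E {..d}"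
  proof
    fix m :: "'n \<Rightarrow> nat" assume m: "m \<in> {m. (\<Sum>i\<in>UNIV. m i) \<le> d}"
    have "m i \<le> d" for i
      using member_le_sum[of i UNIV m] m by fastforce
    then show "m \<in> UNIV \<rightarrow>\<^sub>E {..d}" by auto
  qed
  show "finite ((UNIV :: 'n set) \<rightarrow>\<^sub>E {..d})"
    by (intro finite_PiE) auto
qed

lemma const_in_poly_funs: "(\<lambda>x :: real ^ 'n. a) \<in> poly_funs d"
proof -
  have "(\<Sum>m | (\<Sum>i\<in>UNIV. m i) \<le> d.
           (if m = (\<lambda>_. 0) then a else 0) * (\<Prod>i\<in>UNIV. (x $ i) ^ m i)) = a" for x :: "real ^ 'n"
  proof -
    have "(\<Sum>m | (\<Sum>i\<in>UNIV. m i) \<le> d.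
             (if m = (\<lambda>_. 0) then a else 0) * (\<Prod>i\<in>UNIV. (x $ i) ^ m i))
        = (\<Sum>m | (\<Sum>i\<in>UNIV. (m :: 'n \<Rightarrow> nat) i) \<le> d. if m = (\<lambda>_. 0) then a else 0)"
      by (intro sum.cong) auto
    also have "\<dots> = a"
      by (subst sum.delta) (auto simp: finite_multi_indices)
    finally show ?thesis .
  qed
  then show ?thesis
    unfolding poly_funs_def
    by (intro CollectI exI[of _ "\<lambda>m. if m = (\<lambda>_. 0) then a else 0"]) auto
qed

text \<open>For \<open>f\<close> with values \<open>\<plusminus>1\<close> the error is finite, so \<open>enn2real\<close> loses nothing on it, and
  \<open>sqrt (1 - \<epsilon>\<^sup>2)\<close> is the square root of a nonnegative number.\<close>

lemma rat_err_le_1: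
  assumes "\<forall>x\<in>X. f x \<in> {-1, 1}"
  shows "rat_err X f d \<le> 1"
  unfolding rat_err_def
proof (rule INF_lower2)
  show "((\<lambda>x. 0), (\<lambda>x. 1)) \<in> {(p, q). p \<in> poly_funs d \<and> q \<in> poly_funs d \<and> (\<forall>x\<in>X. q x \<noteq> 0)}"
    by (simp add: const_in_poly_funs)
  show "(case ((\<lambda>x. 0), (\<lambda>x. 1)) of (p, q) \<Rightarrow> SUP x\<in>X. ennreal \<bar>f x - p x / q x\<bar>) \<le> 1"
    using assms by (auto intro!: SUP_least)
qed

end

theory Submission
  imports Defs
begin

text \<open>
  Suppose \<open>p / q\<close> approximates the sign function \<open>f\<close> to within \<open>\<delta> < 1\<close>, and put
  \<open>s = sqrt (1 - \<delta>\<^sup>2)\<close>. Then \<open>u = f p / q\<close> satisfies \<open>(1 - u)\<^sup>2 \<le> 1 - s\<^sup>2\<close>, that is,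
  \<open>u\<^sup>2 + s\<^sup>2 \<le> 2 u\<close>, so \<open>2 s u / (s\<^sup>2 + u\<^sup>2)\<close> lies in \<open>[s, 1]\<close>. Rescaling by \<open>2 / (1 + s)\<close> centres
  this interval at \<open>1\<close> and gives the error \<open>(1 - s) / (1 + s) = (\<delta> / (1 + s))\<^sup>2\<close>, with the positive
  denominator \<open>s\<^sup>2 q\<^sup>2 + p\<^sup>2\<close>. Finally let \<open>\<delta>\<close> decrease to \<open>R(f, d)\<close>.
\<close>

lemma poly_funs_add:
  assumes "p \<in> poly_funs d" "q \<in> poly_funs d"
  shows "(\<lambda>x. p x + q x) \<in> poly_funs d"
proof -
  obtain a b where
    "\<forall>x. p x = (\<Sum>m | (\<Sum>i\<in>UNIV. m i) \<le> d. a m * (\<Prod>i\<in>UNIV. (x $ i) ^ m i))"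
    "\<forall>x. q x = (\<Sum>m | (\<Sum>i\<in>UNIV. m i) \<le> d. b m * (\<Prod>i\<in>UNIV. (x $ i) ^ m i))"
    using assms unfolding poly_funs_def by blast
  then show ?thesis
    unfolding poly_funs_def
    by (intro CollectI exI[of _ "\<lambda>m. a m + b m"]) (simp add: sum.distrib distrib_right)
qed

lemma poly_funs_cmult:
  assumes "p \<in> poly_funs d"
  shows "(\<lambda>x. k * p x) \<in> poly_funs d"
proof -
  obtain a where
    "\<forall>x. p x = (\<Sum>m | (\<Sum>i\<in>UNIV. m i) \<le> d. a m * (\<Prod>i\<in>UNIV. (x $ i) ^ m i))"
    using assms unfolding poly_funs_def by blast
  then show ?thesis
    unfolding poly_funs_def
    by (intro CollectI exI[of _ "\<lambda>m. k * a m"]) (simp add: sum_distrib_left mult.assoc)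
qed

lemma poly_funs_sum:
  assumes "finite A" "\<And>a. a \<in> A \<Longrightarrow> p a \<in> poly_funs d"
  shows "(\<lambda>x. \<Sum>a\<in>A. p a x) \<in> poly_funs d"
  using assms
  by (induction rule: finite_induct) (auto intro: const_in_poly_funs poly_funs_add)

lemma monomial_in_poly_funs:
  fixes m :: "'n::finite \<Rightarrow> nat"
  assumes "(\<Sum>i\<in>UNIV. m i) \<le> d"
  shows "(\<lambda>x. \<Prod>i\<in>UNIV. (x $ i) ^ m i) \<in> poly_funs d"
proof -
  have "(\<Sum>k | (\<Sum>i\<in>UNIV. k i) \<le> d.
          (if k = m then 1 else 0) * (\<Prod>i\<in>UNIV. (x $ i) ^ k i)) = (\<Prod>i\<in>UNIV. (x $ i) ^ m i)"
    for x :: "real ^ 'n"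
  proof -
    have "(\<Sum>k | (\<Sum>i\<in>UNIV. k i) \<le> d.
            (if k = m then 1 else 0) * (\<Prod>i\<in>UNIV. (x $ i) ^ k i))
        = (\<Sum>k | (\<Sum>i\<in>UNIV. k i) \<le> d. if k = m then \<Prod>i\<in>UNIV. (x $ i) ^ k i else 0)"
      by (intro sum.cong) auto
    also have "\<dots> = (\<Prod>i\<in>UNIV. (x $ i) ^ m i)"
      using assms by (subst sum.delta) (auto simp: finite_multi_indices)
    finally show ?thesis .
  qed
  then show ?thesis
    unfolding poly_funs_def
    by (intro CollectI exI[of _ "\<lambda>k. if k = m then 1 else 0"]) auto
qed

text \<open>Distributing gives a double sum of scaled monomials whose exponents
  \<open>m i + k i\<close> have total at most \<open>d + e\<close>. Closure under finite sums and
  scaling then finishes without collecting the convolved coefficients.\<close>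

lemma poly_funs_mult:
  fixes p q :: "real ^ 'n \<Rightarrow> real"
  assumes "p \<in> poly_funs d" "q \<in> poly_funs e"
  shows "(\<lambda>x. p x * q x) \<in> poly_funs (d + e)"
proof -
  obtain a b where
    ab: "\<forall>x. p x = (\<Sum>m | (\<Sum>i\<in>UNIV. m i) \<le> d. a m * (\<Prod>i\<in>UNIV. (x $ i) ^ m i))"
    "\<forall>x. q x = (\<Sum>m | (\<Sum>i\<in>UNIV. m i) \<le> e. b m * (\<Prod>i\<in>UNIV. (x $ i) ^ m i))"
    using assms unfolding poly_funs_def by blast
  have "(\<lambda>x. p x * q x) = (\<lambda>x. \<Sum>m | (\<Sum>i\<in>UNIV. m i) \<le> d. \<Sum>k | (\<Sum>i\<in>UNIV. k i) \<le> e.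
      (a m * b k) * (\<Prod>i\<in>UNIV. (x $ i) ^ (m i + k i)))"
    by (simp add: ab sum_product power_add prod.distrib mult_ac)
  also have "\<dots> \<in> poly_funs (d + e)"
    by (intro poly_funs_sum poly_funs_cmult monomial_in_poly_funs finite_multi_indices)
      (auto simp: sum.distrib intro: add_mono)
  finally show ?thesis .
qed

text \<open>The sign \<sigma> is absent from the new quotient: with r = p / q, the map r \<mapsto> 2
  s r / (s^2 + r^2) is odd, so it carries the sign of r = \<sigma> u through by itself. Hence one
  formula serves the points of both signs.\<close>

lemma rescaled_sign_error:
  fixes \<sigma> p q s :: real
  assumes \<sigma>: "\<sigma> \<in> {-1, 1}" and q: "q \<noteq> 0" and s: "0 < s"
    and err: "(\<sigma> - p / q)\<^sup>2 \<le> 1 - s\<^sup>2"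
  shows "\<bar>\<sigma> - (4 * s / (1 + s) * (p * q)) / (s\<^sup>2 * (q * q) + p * p)\<bar> \<le> (1 - s) / (1 + s)"
proof -
  define u where "u = \<sigma> * (p / q)"
  have \<sigma>2: "\<sigma> * \<sigma> = 1" using \<sigma> by auto
  have p: "p = \<sigma> * u * q" using q \<sigma>2 by (simp add: u_def flip: mult.assoc)
  have "(\<sigma> - p / q)\<^sup>2 = (1 - u)\<^sup>2"
    using \<sigma> by (auto simp: u_def power2_eq_square algebra_simps)
  then have u: "u\<^sup>2 + s\<^sup>2 \<le> 2 * u"
    using err by (simp add: power2_eq_square algebra_simps)
  define D where "D = s\<^sup>2 + u\<^sup>2"
  have D: "D > 0" unfolding D_def using s by (simp add: add_pos_nonneg)
  define t where "t = 2 * s * u / D"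
  have "s * D \<le> s * (2 * u)"
    using u s by (intro mult_left_mono) (auto simp: D_def)
  then have t_ge: "s \<le> t"
    using D by (simp add: t_def pos_le_divide_eq mult_ac)
  have "2 * s * u \<le> D"
    unfolding D_def by (rule sum_squares_bound)
  then have t_le: "t \<le> 1"
    using D by (simp add: t_def)
  have "p * p = (\<sigma> * \<sigma>) * (u\<^sup>2 * q\<^sup>2)"
    by (simp add: p power2_eq_square mult_ac)
  then have den: "s\<^sup>2 * (q * q) + p * p = D * q\<^sup>2"
    by (simp add: \<sigma>2 D_def power2_eq_square algebra_simps)
  have num: "4 * s / (1 + s) * (p * q) = \<sigma> * (2 / (1 + s) * (2 * s * u)) * q\<^sup>2"
    by (simp add: p power2_eq_square)
  have "(4 * s / (1 + s) * (p * q)) / (s\<^sup>2 * (q * q) + p * p) = \<sigma> * (2 / (1 + s) * t)"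
    unfolding den num using q by (simp add: t_def)
  then have "\<bar>\<sigma> - (4 * s / (1 + s) * (p * q)) / (s\<^sup>2 * (q * q) + p * p)\<bar>
      = \<bar>1 - 2 / (1 + s) * t\<bar>"
    using \<sigma> by auto
  also have "1 - 2 / (1 + s) * t = (1 + s - 2 * t) / (1 + s)"
    using s by (simp add: field_simps)
  also have "\<bar>\<dots>\<bar> = \<bar>1 + s - 2 * t\<bar> / (1 + s)"
    using s by simp
  \<comment> \<open>As t ranges over [s, 1], the numerator 1 + s - 2 t ranges over
    [-(1 - s), 1 - s].\<close>
  also have "\<dots> \<le> (1 - s) / (1 + s)"
    using s t_ge t_le by (intro divide_right_mono) auto
  finally show ?thesis .
qed

text \<open>The infimum need not be attained; the strict inequality supplies an actual pair p, q
  with error below \<delta>.\<close>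

lemma rat_err_pos_le_of_rat_err_less:
  fixes X :: "(real ^ 'n) set"
  assumes f: "\<forall>x\<in>X. f x \<in> {-1, 1}" and \<delta>: "0 \<le> \<delta>" "\<delta> < 1"
    and less: "rat_err X f d < ennreal \<delta>"
  shows "rat_err_pos X f (2 * d) \<le> ennreal ((\<delta> / (1 + sqrt (1 - \<delta>\<^sup>2)))\<^sup>2)"
proof -
  obtain p q where pq: "p \<in> poly_funs d" "q \<in> poly_funs d" "\<forall>x\<in>X. q x \<noteq> 0"
    and sup: "(SUP x\<in>X. ennreal \<bar>f x - p x / q x\<bar>) < ennreal \<delta>"
    using less unfolding rat_err_def by (auto simp: INF_less_iff)
  define s where "s = sqrt (1 - \<delta>\<^sup>2)"
  have \<delta>2: "\<delta>\<^sup>2 < 1"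
    using \<delta> by (simp add: power_less_one_iff abs_square_less_1)
  have s: "s > 0" and s2: "s\<^sup>2 = 1 - \<delta>\<^sup>2"
    using \<delta>2 by (auto simp: s_def)
  \<comment> \<open>Here \<open>\<delta>\<^sup>2 = 1 - s\<^sup>2\<close> is factored so that 1 + s
    cancels.\<close>
  have "(\<delta> / (1 + s))\<^sup>2 = ((1 - s) * (1 + s)) / ((1 + s) * (1 + s))"
    using s2 by (simp add: power_divide power2_eq_square algebra_simps)
  then have bound: "(\<delta> / (1 + s))\<^sup>2 = (1 - s) / (1 + s)"
    using s by simp
  \<comment> \<open>\<open>P / Q\<close> is 2 / (1 + s) times 2 s r / (s^2 + r^2) at r = p / q,
    expanded by q^2; this is where the degree doubles.\<close>
  define P where "P = (\<lambda>x. 4 * s / (1 + s) * (p x * q x))"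
  define Q where "Q = (\<lambda>x. s\<^sup>2 * (q x * q x) + p x * p x)"
  have P: "P \<in> poly_funs (2 * d)"
    unfolding P_def mult_2 by (intro poly_funs_cmult poly_funs_mult pq)
  have Q: "Q \<in> poly_funs (2 * d)"
    unfolding Q_def mult_2 by (intro poly_funs_add poly_funs_cmult poly_funs_mult pq)
  have Q_pos: "\<forall>x\<in>X. Q x > 0"
    using pq(3) s unfolding Q_def
    by (auto intro!: add_pos_nonneg mult_pos_pos simp flip: power2_eq_square)
  have err: "\<bar>f x - P x / Q x\<bar> \<le> (1 - s) / (1 + s)" if x: "x \<in> X" for x
  proof -
    have "ennreal \<bar>f x - p x / q x\<bar> < ennreal \<delta>"
      using sup x by (meson SUP_upper le_less_trans)
    then have "\<bar>f x - p x / q x\<bar> \<le> \<bar>\<delta>\<bar>"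
      by (simp add: ennreal_less_iff)
    then have "(f x - p x / q x)\<^sup>2 \<le> 1 - s\<^sup>2"
      unfolding s2 by (simp add: abs_le_square_iff)
    then show ?thesis
      unfolding P_def Q_def using f pq(3) s x by (intro rescaled_sign_error) auto
  qed
  have "rat_err_pos X f (2 * d) \<le> (SUP x\<in>X. ennreal \<bar>f x - P x / Q x\<bar>)"
    unfolding rat_err_pos_def using P Q Q_pos by (intro INF_lower2[of "(P, Q)"]) auto
  also have "\<dots> \<le> ennreal ((1 - s) / (1 + s))"
    using err by (intro SUP_least ennreal_leI)
  finally show ?thesis
    by (simp add: bound flip: s_def)
qed

text \<open>This serves the case \<epsilon> = 1, where no \<delta> lies strictly between \<epsilon>
  and 1 and the claimed bound equals 1.\<close>

lemma rat_err_pos_le_1: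
  assumes "\<forall>x\<in>X. f x \<in> {-1, 1}"
  shows "rat_err_pos X f d \<le> 1"
  unfolding rat_err_pos_def
proof (rule INF_lower2)
  show "((\<lambda>x. 0), (\<lambda>x. 1)) \<in> {(p, q). p \<in> poly_funs d \<and> q \<in> poly_funs d \<and> (\<forall>x\<in>X. q x > 0)}"
    by (simp add: const_in_poly_funs)
  show "(case ((\<lambda>x. 0), (\<lambda>x. 1)) of (p, q) \<Rightarrow> SUP x\<in>X. ennreal \<bar>f x - p x / q x\<bar>) \<le> 1"
    using assms by (auto intro!: SUP_least)
qed

theorem theorem3p13:
  fixes X :: "(real ^ 'n) set" and f :: "real ^ 'n \<Rightarrow> real" and d :: nat and \<epsilon> :: real
  assumes "\<forall>x\<in>X. f x \<in> {-1, 1}"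
    and "\<epsilon> = enn2real (rat_err X f d)"
  shows "rat_err_pos X f (2 * d) \<le> ennreal ((\<epsilon> / (1 + sqrt (1 - \<epsilon>\<^sup>2)))\<^sup>2)"
proof -
  have le1: "rat_err X f d \<le> 1"
    using assms(1) by (rule rat_err_le_1)
  then have "rat_err X f d < top"
    by (rule le_less_trans) simp
  then have \<epsilon>: "rat_err X f d = ennreal \<epsilon>" and \<epsilon>0: "0 \<le> \<epsilon>"
    by (simp_all add: assms(2))
  then have "\<epsilon> \<le> 1"
    using le1 by simp
  then consider "\<epsilon> = 1" | "\<epsilon> < 1"
    by linarith
  then show ?thesis
  proof cases
    case 1
    then show ?thesis
      using rat_err_pos_le_1[OF assms(1)] by simp
  next
    case 2
    define g where "g = (\<lambda>\<delta>::real. (\<delta> / (1 + sqrt (1 - \<delta>\<^sup>2)))\<^sup>2)"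
    have "\<epsilon>\<^sup>2 \<le> 1"
      using \<epsilon>0 2 by (simp add: power_le_one)
    then have "1 + sqrt (1 - \<epsilon>\<^sup>2) > 0"
      by (intro add_pos_nonneg) auto
    \<comment> \<open>The denominator is nonzero at \<epsilon>, so \<open>g\<close> is continuous
      there and the bounds for \<delta> > \<epsilon> pass to the limit.\<close>
    then have "(g \<longlongrightarrow> g \<epsilon>) (at_right \<epsilon>)"
      unfolding g_def by (intro tendsto_intros) auto
    then have "((\<lambda>\<delta>. ennreal (g \<delta>)) \<longlongrightarrow> ennreal (g \<epsilon>)) (at_right \<epsilon>)"
      by (rule tendsto_ennrealI)
    \<comment> \<open>Near \<epsilon> on the right, \<delta> stays in the open interval from
      \<epsilon> to 1, which is nonempty as \<epsilon> < 1.\<close>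
    moreover have "\<forall>\<^sub>F \<delta> in at_right \<epsilon>. rat_err_pos X f (2 * d) \<le> ennreal (g \<delta>)"
      using eventually_at_right_real[OF 2]
    proof eventually_elim
      case (elim \<delta>)
      with \<epsilon>0 show ?case
        unfolding g_def
        by (intro rat_err_pos_le_of_rat_err_less assms(1)) (auto simp: \<epsilon> ennreal_less_iff)
    qed
    ultimately have "rat_err_pos X f (2 * d) \<le> ennreal (g \<epsilon>)"
      by (intro tendsto_lowerbound) auto
    then show ?thesis
      by (simp add: g_def)
  qed
qed

end
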